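(* If $n$ is a non-negative integer and $r$, $s$ and $t$ are any integers, then, with all sums over $k$ from $0$ to $\lfloor n/2\rfloor$, \[ 10\sum_{k} \binom n{2k}F_{2k + r} F_{2k + s} F_{2k + t} = 2^n \big( F_{2n + s + r + t} + ( - 1)^n F_{n + s + r + t} \bigr) - ( - 1)^r \bigl( F_{2n + s + t - r} - ( - 1)^{s + t - r} F_{n - s - t + r} \bigr) - ( - 1)^t L_{s - t} \bigl( F_{2n + r} - ( - 1)^r F_{n - r} \bigr), \] \[ 10\sum_{k} \binom n{2k}L_{2k + r} F_{2k + s} F_{2k + t} = 2^n \bigl( L_{2n + s + r + t} + ( - 1)^n L_{n + s + r + t} \bigr) + ( - 1)^r \bigl( L_{2n + s + t - r} + ( - 1)^{s + t - r} L_{n - s - t + r} \bigr) - ( - 1)^t L_{s - t} \bigl( L_{2n + r} + ( - 1)^r L_{n - r} \bigr), \] \[ 2\sum_{k} \binom n{2k}L_{2k + r} L_{2k + s} F_{2k + t} = 2^n \bigl( F_{2n + s + r + t} + ( - 1)^n F_{n + s + r + t} \bigr) + ( - 1)^r \bigl( F_{2n + s + t - r} - ( - 1)^{s + t - r} F_{n - s - t + r} \bigr) - ( - 1)^t F_{s - t} \bigl( L_{2n + r} + ( - 1)^r L_{n - r} \bigr), \] \[ 2\sum_{k} \binom n{2k}L_{2k + r} L_{2k + s} L_{2k + t} = 2^n \bigl( L_{2n + s + r + t} + ( - 1)^n L_{n + s + r + t} \bigr) + ( - 1)^r \bigl( L_{2n + s + t - r} + ( - 1)^{s + t - r} L_{n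 - s - t + r} \bigr)+ ( - 1)^t L_{s - t} \bigl( L_{2n + r} + ( - 1)^r L_{n - r} \bigr). \]
   Context: The Fibonacci numbers $F_j$ and Lucas numbers $L_j$ are defined for all integers $j$ by $F_0=0$, $F_1=1$, $L_0=2$, $L_1=1$, $F_j=F_{j-1}+F_{j-2}$, $L_j=L_{j-1}+L_{j-2}$, with $F_{-j}=(-1)^{j-1}F_j$ and $L_{-j}=(-1)^jL_j$. *)

theory Defs
  imports Complex_Main "HOL-Number_Theory.Fib"
begin

definition fibz :: "int \<Rightarrow> int" where
  "fibz j = (if j \<ge> 0 then int (fib (nat j))
             else (-1) ^ (nat (- j) - 1) * int (fib (nat (- j))))"

fun lucas_nat :: "nat \<Rightarrow> nat" where
  "lucas_nat 0 = 2"
| "lucas_nat (Suc 0) = 1"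
| "lucas_nat (Suc (Suc n)) = lucas_nat (Suc n) + lucas_nat n"

definition lucasz :: "int \<Rightarrow> int" where
  "lucasz j = (if j \<ge> 0 then int (lucas_nat (nat j))
               else (-1) ^ nat (- j) * int (lucas_nat (nat (- j))))"

lemma fibz_0: "fibz 0 = 0" and fibz_1: "fibz 1 = 1"
  by (simp_all add: fibz_def)

lemma lucasz_0: "lucasz 0 = 2" and lucasz_1: "lucasz 1 = 1"
  by (simp_all add: lucasz_def)

lemma fibz_rec: "fibz j = fibz (j - 1) + fibz (j - 2)"
proof -
  consider m where "j = int (Suc (Suc m))" | "j = 1" | "j = 0" | m where "j = - int (Suc m)"
  proof -
    have "j \<ge> 2 \<or> j = 1 \<or> j = 0 \<or> j \<le> - 1" by linarith
    moreover have "j = int (Suc (Suc (nat (j - 2))))" if "j \<ge> 2" using that by simp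
    moreover have "j = - int (Suc (nat (- j - 1)))" if "j \<le> - 1" using that by simp
    ultimately show thesis using that by blast
  qed
  then show ?thesis
  proof cases
    case 1
    then have "nat j = Suc (Suc m)" "nat (j - 1) = Suc m" "nat (j - 2) = m" by simp_all
    with 1 show ?thesis by (simp add: fibz_def)
  next
    case 4
    then have "nat (- j) = Suc m" "nat (1 - j) = Suc (Suc m)" "nat (2 - j) = Suc (Suc (Suc m))"
      by simp_all
    with 4 show ?thesis by (simp add: fibz_def algebra_simps)
  qed (simp_all add: fibz_def numeral_2_eq_2)
qed

lemma lucasz_rec: "lucasz j = lucasz (j - 1) + lucasz (j - 2)"
proof -
  consider m where "j = int (Suc (Suc m))" | "j = 1" | "j = 0" | m where "j = - int (Suc m)"
  proof -
    have "j \<ge> 2 \<or> j = 1 \<or> j = 0 \<or> j \<le> - 1" by linarith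
    moreover have "j = int (Suc (Suc (nat (j - 2))))" if "j \<ge> 2" using that by simp
    moreover have "j = - int (Suc (nat (- j - 1)))" if "j \<le> - 1" using that by simp
    ultimately show thesis using that by blast
  qed
  then show ?thesis
  proof cases
    case 1
    then have "nat j = Suc (Suc m)" "nat (j - 1) = Suc m" "nat (j - 2) = m" by simp_all
    with 1 show ?thesis by (simp add: lucasz_def)
  next
    case 4
    then have "nat (- j) = Suc m" "nat (1 - j) = Suc (Suc m)" "nat (2 - j) = Suc (Suc (Suc m))"
      by simp_all
    with 4 show ?thesis by (simp add: lucasz_def algebra_simps)
  qed (simp_all add: lucasz_def numeral_2_eq_2)
qed

end

theory Submission
  imports Defs
begin

text \<open>
  Product-to-sum formulas turn each summand into a combination of terms of index \<open>6k + m\<close> and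
  \<open>2k + m\<close>. By Binet's formula the sums reduce to even parts of binomial expansions at \<open>x ^ 3\<close> and
  \<open>x\<close>, where \<open>x\<close> is a root of \<open>x\<^sup>2 = x + 1\<close>; there \<open>1 + x ^ 3 = 2 x\<^sup>2\<close>, \<open>1 - x ^ 3 = - 2 x\<close>,
  \<open>1 + x = x\<^sup>2\<close>, and \<open>1 - x\<close> is the conjugate root.
\<close>

text \<open>Adding the expansions at \<open>x\<close> and \<open>- x\<close> doubles the even powers
  and cancels the odd ones. The lemma is used below at \<open>x\<close> and at \<open>x ^ 3\<close>
  for the golden ratio and its conjugate.\<close>

lemma sum_even_binomial:
  fixes x :: "'a :: comm_ring_1"
  shows "2 * (\<Sum>k = 0..n div 2. of_nat (n choose (2 * k)) * x ^ (2 * k)) = (1 + x) ^ n + (1 - x) ^ n"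
proof -
  have "(1 + x) ^ n + (1 - x) ^ n = (x + 1) ^ n + (- x + 1) ^ n"
    by (simp add: add.commute)
  also have "\<dots> = (\<Sum>i\<le>n. of_nat (n choose i) * (x ^ i + (- x) ^ i))"
    unfolding binomial_ring by (simp add: sum.distrib algebra_simps)
  \<comment> \<open>For odd \<open>i\<close> the bracket \<open>x ^ i + (- x) ^ i\<close> is
    zero.\<close>
  also have "\<dots> = (\<Sum>i\<in>{i. i \<le> n \<and> even i}. of_nat (n choose i) * (x ^ i + (- x) ^ i))"
    by (rule sum.mono_neutral_right) auto
  also have "\<dots> = (\<Sum>k = 0..n div 2. of_nat (n choose (2 * k)) * (x ^ (2 * k) + (- x) ^ (2 * k)))"
    by (rule sum.reindex_bij_witness[of _ "\<lambda>k. 2 * k" "\<lambda>i. i div 2"]) auto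
  also have "\<dots> = 2 * (\<Sum>k = 0..n div 2. of_nat (n choose (2 * k)) * x ^ (2 * k))"
    by (simp add: sum_distrib_left algebra_simps)
  finally show ?thesis by simp
qed

section \<open>Binet's formulas for all integer indices\<close>

definition gold :: real where "gold = (1 + sqrt 5) / 2"
definition gold_conj :: real where "gold_conj = (1 - sqrt 5) / 2"

lemma gold_square: "gold\<^sup>2 = gold + 1" and gold_conj_square: "gold_conj\<^sup>2 = gold_conj + 1"
  by (simp_all add: gold_def gold_conj_def power2_eq_square field_simps)

lemma gold_conj_eq: "gold_conj = 1 - gold" and gold_eq: "gold = 1 - gold_conj"
  by (simp_all add: gold_def gold_conj_def field_simps)

lemma gold_root_nonzero:
  fixes x :: real
  assumes "x\<^sup>2 = x + 1"
  shows "x \<noteq> 0"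
  using assms by auto

lemma gold_nonzero: "gold \<noteq> 0" and gold_conj_nonzero: "gold_conj \<noteq> 0"
  using gold_square gold_conj_square gold_root_nonzero by blast+

lemma gold_mult_gold_conj: "gold * gold_conj = - 1"
  by (simp add: gold_def gold_conj_def field_simps)

text \<open>This is \<open>x\<^sup>2 = x + 1\<close> multiplied by \<open>x powi (j - 2)\<close>.
  Since \<open>x\<close> is nonzero, the power laws hold for negative exponents too.\<close>

lemma gold_power_int_rec:
  fixes x :: real
  assumes "x\<^sup>2 = x + 1"
  shows "x powi j = x powi (j - 1) + x powi (j - 2)"
proof -
  have "x powi j = x powi (j - 2) * x\<^sup>2"
    using gold_root_nonzero[OF assms] by (simp add: power_int_diff)
  also have "\<dots> = x powi (j - 2) * x + x powi (j - 2)"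
    by (simp add: assms algebra_simps)
  also have "x powi (j - 2) * x = x powi (j - 1)"
    using gold_root_nonzero[OF assms] by (simp add: power_int_diff power2_eq_square)
  finally show ?thesis .
qed

text \<open>Two adjacent values determine a solution in both directions, because the recurrence can
  also be solved for its last term.\<close>

lemma fibonacci_recurrence_unique:
  fixes f g :: "int \<Rightarrow> real"
  assumes f: "\<And>j. f j = f (j - 1) + f (j - 2)" and g: "\<And>j. g j = g (j - 1) + g (j - 2)"
    and "f 0 = g 0" "f 1 = g 1"
  shows "f j = g j"
proof -
  \<comment> \<open>Carrying a pair of neighbours gives the second-order recurrence both of its
    inputs, upwards and downwards from 0.\<close>
  have "f j = g j \<and> f (j + 1) = g (j + 1)"
  proof (induction j rule: int_induct[where k = 0])
    case base
    then show ?case using assms(3,4) by simp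
  next
    case (step1 i)
    then show ?case using f[of "i + 2"] g[of "i + 2"] by (simp add: add.commute)
  next
    case (step2 i)
    then show ?case using f[of "i + 1"] g[of "i + 1"] by simp
  qed
  then show ?thesis by simp
qed

text \<open>Both sides satisfy the Fibonacci recurrence on all of the integers and agree at 0 and 1,
  so negative indices take no separate computation.\<close>

lemma lucasz_binet: "real_of_int (lucasz j) = gold powi j + gold_conj powi j"
proof (rule fibonacci_recurrence_unique)
  show "real_of_int (lucasz j) = real_of_int (lucasz (j - 1)) + real_of_int (lucasz (j - 2))" for j
    by (subst lucasz_rec) simp
  show "gold powi j + gold_conj powi j = gold powi (j - 1) + gold_conj powi (j - 1)
      + (gold powi (j - 2) + gold_conj powi (j - 2))" for j
    using gold_power_int_rec[OF gold_square, of j] gold_power_int_rec[OF gold_conj_square, of j] by simp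
qed (simp_all add: lucasz_0 lucasz_1 gold_conj_eq)

lemma fibz_binet: "real_of_int (fibz j) = (gold powi j - gold_conj powi j) / sqrt 5"
proof (rule fibonacci_recurrence_unique)
  show "real_of_int (fibz j) = real_of_int (fibz (j - 1)) + real_of_int (fibz (j - 2))" for j
    by (subst fibz_rec) simp
  show "(gold powi j - gold_conj powi j) / sqrt 5 = (gold powi (j - 1) - gold_conj powi (j - 1)) / sqrt 5
      + (gold powi (j - 2) - gold_conj powi (j - 2)) / sqrt 5" for j
    using gold_power_int_rec[OF gold_square, of j] gold_power_int_rec[OF gold_conj_square, of j]
    by (simp add: add_divide_distrib[symmetric])
qed (simp_all add: fibz_0 fibz_1 gold_def gold_conj_def field_simps)

section \<open>Product-to-sum formulas\<close>

lemma power_int_diff_of_mult_eq_minus_one: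
  fixes x y :: real
  assumes "x * y = - 1"
  shows "(- 1) powi b * x powi (a - b) = x powi a * y powi b"
proof -
  have "x \<noteq> 0" using assms by auto
  \<comment> \<open>Here \<open>- 1\<close> is read as \<open>x * y\<close>: the factor
    \<open>x powi b\<close> cancels the denominator of \<open>x powi (a - b)\<close> and
    \<open>y powi b\<close> remains.\<close>
  then have "(x * y) powi b * x powi (a - b) = x powi a * y powi b"
    by (simp add: power_int_mult_distrib power_int_diff)
  then show ?thesis by (simp add: assms)
qed

lemmas gold_power_int_diff = power_int_diff_of_mult_eq_minus_one[OF gold_mult_gold_conj]
lemmas gold_conj_power_int_diff =
  power_int_diff_of_mult_eq_minus_one[OF gold_mult_gold_conj[unfolded mult.commute[of gold]]]

lemma lucasz_minus_one_power_diff: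
  "(- 1) powi b * real_of_int (lucasz (a - b)) = gold powi a * gold_conj powi b + gold_conj powi a * gold powi b"
  by (simp add: lucasz_binet distrib_left gold_power_int_diff gold_conj_power_int_diff)

lemma fibz_minus_one_power_diff:
  "(- 1) powi b * real_of_int (fibz (a - b))
    = (gold powi a * gold_conj powi b - gold_conj powi a * gold powi b) / sqrt 5"
  by (simp add: fibz_binet right_diff_distrib gold_power_int_diff gold_conj_power_int_diff)

lemmas gold_power_int_add = power_int_add[OF disjI1[OF gold_nonzero]]
lemmas gold_conj_power_int_add = power_int_add[OF disjI1[OF gold_conj_nonzero]]

text \<open>Expanding the Binet forms, the two unmixed terms give index \<open>a + b\<close>, and
  the two mixed terms are those of \<open>lucasz_minus_one_power_diff\<close>.\<close>

lemma lucasz_mult_lucasz: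
  "real_of_int (lucasz a) * real_of_int (lucasz b)
    = real_of_int (lucasz (a + b)) + (- 1) powi b * real_of_int (lucasz (a - b))"
  unfolding lucasz_minus_one_power_diff
  by (simp add: lucasz_binet gold_power_int_add gold_conj_power_int_add algebra_simps)

text \<open>The mixed terms now have opposite signs. Which factor is the Fibonacci number decides
  the sign of the \<open>a - b\<close> term, hence the separate mirror formula
  \<open>fibz_mult_lucasz\<close>.\<close>

lemma lucasz_mult_fibz:
  "real_of_int (lucasz a) * real_of_int (fibz b)
    = real_of_int (fibz (a + b)) - (- 1) powi b * real_of_int (fibz (a - b))"
  unfolding fibz_minus_one_power_diff
  by (simp add: lucasz_binet fibz_binet gold_power_int_add gold_conj_power_int_add field_simps)

lemma fibz_mult_lucasz:
  "real_of_int (fibz a) * real_of_int (lucasz b)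
    = real_of_int (fibz (a + b)) + (- 1) powi b * real_of_int (fibz (a - b))"
  unfolding fibz_minus_one_power_diff
  by (simp add: lucasz_binet fibz_binet gold_power_int_add gold_conj_power_int_add field_simps)

text \<open>The factor 5 clears the two denominators \<open>sqrt 5\<close> from Binet's
  formula.\<close>

lemma fibz_mult_fibz:
  "5 * (real_of_int (fibz a) * real_of_int (fibz b))
    = real_of_int (lucasz (a + b)) - (- 1) powi b * real_of_int (lucasz (a - b))"
  unfolding lucasz_minus_one_power_diff
  by (simp add: lucasz_binet fibz_binet gold_power_int_add gold_conj_power_int_add field_simps)

section \<open>Even binomial sums along the indices \<open>6 * k + m\<close> and
  \<open>2 * k + m\<close>\<close>

lemma sum_even_binomial_gold_cubed:
  fixes x :: real
  assumes x: "x\<^sup>2 = x + 1"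
  shows "2 * (\<Sum>k = 0..n div 2. real (n choose (2 * k)) * x powi (6 * int k + m))
    = 2 ^ n * (x powi (2 * int n + m) + (- 1) ^ n * x powi (int n + m))"
proof -
  note nz = gold_root_nonzero[OF x]
  have cube: "x ^ 3 = 2 * x + 1"
    using x by (simp add: power3_eq_cube power2_eq_square algebra_simps)
  \<comment> \<open>By \<open>cube\<close>, the left sides are \<open>2 * x + 2\<close> and
    \<open>- 2 * x\<close>. Both are monomials in \<open>x\<close> up to constants, so their
    \<open>n\<close>-th powers are again powers of \<open>x\<close>. Keeping \<open>- 1\<close> as a
    separate factor produces \<open>(- 1) ^ n\<close>.\<close>
  have plus: "1 + x ^ 3 = 2 * x\<^sup>2" and minus: "1 - x ^ 3 = 2 * (- 1) * x"
    using x cube by simp_all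
  have "x powi (6 * int k + m) = (x ^ 3) ^ (2 * k) * x powi m" for k
  proof -
    have "x powi (6 * int k) = x ^ (6 * k)"
      using power_int_of_nat[of x "6 * k"] by simp
    then show ?thesis by (simp add: power_int_add nz flip: power_mult)
  qed
  then have "2 * (\<Sum>k = 0..n div 2. real (n choose (2 * k)) * x powi (6 * int k + m))
      = 2 * (\<Sum>k = 0..n div 2. real (n choose (2 * k)) * (x ^ 3) ^ (2 * k)) * x powi m"
    by (simp add: sum_distrib_right mult.assoc)
  also have "\<dots> = ((1 + x ^ 3) ^ n + (1 - x ^ 3) ^ n) * x powi m"
    by (simp only: sum_even_binomial)
  also have "\<dots> = (2 ^ n * x ^ (2 * n) + 2 ^ n * (- 1) ^ n * x ^ n) * x powi m"
    unfolding plus minus power_mult_distrib power_mult ..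
  also have "x ^ (2 * n) = x powi (2 * int n)"
    using power_int_of_nat[of x "2 * n"] by simp
  finally show ?thesis by (simp add: power_int_add nz algebra_simps)
qed

text \<open>Writing the conjugate root as \<open>1 - x\<close> lets one statement serve both roots.
  As the roots multiply to \<open>- 1\<close>, the term \<open>(1 - x) ^ n * x powi m\<close>
  becomes a signed power of the conjugate alone.\<close>

lemma sum_even_binomial_gold:
  fixes x :: real
  assumes x: "x\<^sup>2 = x + 1"
  shows "2 * (\<Sum>k = 0..n div 2. real (n choose (2 * k)) * x powi (2 * int k + m))
    = x powi (2 * int n + m) + (- 1) powi m * (1 - x) powi (int n - m)"
proof -
  note nz = gold_root_nonzero[OF x]
  have plus: "1 + x = x\<^sup>2" using x by simp
  have "(1 - x) * x = - 1" using x by (simp add: power2_eq_square algebra_simps)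
  then have minus: "(- 1) powi m * (1 - x) powi (int n - m) = (1 - x) ^ n * x powi m"
    using power_int_diff_of_mult_eq_minus_one[of "1 - x" x m "int n"] by simp
  have even: "x powi (2 * int k) = x ^ (2 * k)" for k
    using power_int_of_nat[of x "2 * k"] by simp
  have "2 * (\<Sum>k = 0..n div 2. real (n choose (2 * k)) * x powi (2 * int k + m))
      = 2 * (\<Sum>k = 0..n div 2. real (n choose (2 * k)) * x ^ (2 * k)) * x powi m"
    by (simp add: sum_distrib_right power_int_add nz even mult.assoc)
  also have "\<dots> = ((1 + x) ^ n + (1 - x) ^ n) * x powi m"
    by (simp only: sum_even_binomial)
  also have "\<dots> = x powi (2 * int n + m) + (1 - x) ^ n * x powi m"
    unfolding plus by (simp add: power_int_add nz even distrib_right flip: power_mult)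
  finally show ?thesis unfolding minus .
qed

text \<open>By Binet's formula this is the difference of the power sums at the two roots, divided by
  \<open>sqrt 5\<close>; the Lucas version takes their sum.\<close>

lemma sum_even_binomial_fibz_6:
  "2 * (\<Sum>k = 0..n div 2. real (n choose (2 * k)) * real_of_int (fibz (6 * int k + m)))
    = 2 ^ n * (real_of_int (fibz (2 * int n + m)) + (- 1) ^ n * real_of_int (fibz (int n + m)))" (is "_ = ?rhs")
proof -
  have "2 * (\<Sum>k = 0..n div 2. real (n choose (2 * k)) * real_of_int (fibz (6 * int k + m)))
      = (2 * (\<Sum>k = 0..n div 2. real (n choose (2 * k)) * gold powi (6 * int k + m))
        - 2 * (\<Sum>k = 0..n div 2. real (n choose (2 * k)) * gold_conj powi (6 * int k + m))) / sqrt 5"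
    by (simp add: fibz_binet right_diff_distrib sum_subtractf diff_divide_distrib flip: sum_divide_distrib)
  also have "\<dots> = ?rhs"
    unfolding sum_even_binomial_gold_cubed[OF gold_square] sum_even_binomial_gold_cubed[OF gold_conj_square]
    by (simp add: fibz_binet diff_divide_distrib add_divide_distrib algebra_simps)
  finally show ?thesis .
qed

lemma sum_even_binomial_lucasz_6:
  "2 * (\<Sum>k = 0..n div 2. real (n choose (2 * k)) * real_of_int (lucasz (6 * int k + m)))
    = 2 ^ n * (real_of_int (lucasz (2 * int n + m)) + (- 1) ^ n * real_of_int (lucasz (int n + m)))" (is "_ = ?rhs")
proof -
  have "2 * (\<Sum>k = 0..n div 2. real (n choose (2 * k)) * real_of_int (lucasz (6 * int k + m)))
      = 2 * (\<Sum>k = 0..n div 2. real (n choose (2 * k)) * gold powi (6 * int k + m))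
        + 2 * (\<Sum>k = 0..n div 2. real (n choose (2 * k)) * gold_conj powi (6 * int k + m))"
    by (simp add: lucasz_binet distrib_left sum.distrib)
  also have "\<dots> = ?rhs"
    unfolding sum_even_binomial_gold_cubed[OF gold_square] sum_even_binomial_gold_cubed[OF gold_conj_square]
    by (simp add: lucasz_binet algebra_simps)
  finally show ?thesis .
qed

text \<open>The map from \<open>x\<close> to \<open>1 - x\<close> swaps the two roots. The
  difference of their powers changes sign, whence the minus before the index
  \<open>int n - m\<close>; in the Lucas version the sum is symmetric and the sign is plus.\<close>

lemma sum_even_binomial_fibz_2:
  "2 * (\<Sum>k = 0..n div 2. real (n choose (2 * k)) * real_of_int (fibz (2 * int k + m)))
    = real_of_int (fibz (2 * int n + m)) - (- 1) powi m * real_of_int (fibz (int n - m))" (is "_ = ?rhs")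
proof -
  have "2 * (\<Sum>k = 0..n div 2. real (n choose (2 * k)) * real_of_int (fibz (2 * int k + m)))
      = (2 * (\<Sum>k = 0..n div 2. real (n choose (2 * k)) * gold powi (2 * int k + m))
        - 2 * (\<Sum>k = 0..n div 2. real (n choose (2 * k)) * gold_conj powi (2 * int k + m))) / sqrt 5"
    by (simp add: fibz_binet right_diff_distrib sum_subtractf diff_divide_distrib flip: sum_divide_distrib)
  also have "\<dots> = ?rhs"
    unfolding sum_even_binomial_gold[OF gold_square] sum_even_binomial_gold[OF gold_conj_square]
      gold_conj_eq[symmetric] gold_eq[symmetric]
    by (simp add: fibz_binet diff_divide_distrib add_divide_distrib algebra_simps)
  finally show ?thesis .
qed

lemma sum_even_binomial_lucasz_2:
  "2 * (\<Sum>k = 0..n div 2. real (n choose (2 * k)) * real_of_int (lucasz (2 * int k + m)))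
    = real_of_int (lucasz (2 * int n + m)) + (- 1) powi m * real_of_int (lucasz (int n - m))" (is "_ = ?rhs")
proof -
  have "2 * (\<Sum>k = 0..n div 2. real (n choose (2 * k)) * real_of_int (lucasz (2 * int k + m)))
      = 2 * (\<Sum>k = 0..n div 2. real (n choose (2 * k)) * gold powi (2 * int k + m))
        + 2 * (\<Sum>k = 0..n div 2. real (n choose (2 * k)) * gold_conj powi (2 * int k + m))"
    by (simp add: lucasz_binet distrib_left sum.distrib)
  also have "\<dots> = ?rhs"
    unfolding sum_even_binomial_gold[OF gold_square] sum_even_binomial_gold[OF gold_conj_square]
      gold_conj_eq[symmetric] gold_eq[symmetric]
    by (simp add: lucasz_binet algebra_simps)
  finally show ?thesis .
qed

section \<open>Triple products as combinations of single terms\<close>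

lemma minus_one_powi_even_add: "(- 1 :: real) powi (2 * i + j) = (- 1) powi j"
  by (simp add: power_int_add power_int_mult)

context
  fixes k r s t :: int
begin

text \<open>These bring the indices of the product formulas into the form of a multiple of
  \<open>k\<close> plus a constant, as the summation lemmas expect.\<close>

private lemma indices:
  "(2 * k + s) + (2 * k + t) = 4 * k + (s + t)" "(2 * k + s) - (2 * k + t) = s - t"
  "(4 * k + (s + t)) + (2 * k + r) = 6 * k + (s + r + t)"
  "(4 * k + (s + t)) - (2 * k + r) = 2 * k + (s + t - r)"
  by simp_all

private lemmas pair_simps = indices(1,2) minus_one_powi_even_add
private lemmas triple_simps = indices(3,4) minus_one_powi_even_add

text \<open>The factors with \<open>s\<close> and \<open>t\<close> are combined first, giving index
  \<open>4 * k + (s + t)\<close> and a term with \<open>s - t\<close>, which is constant in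
  \<open>k\<close>. Multiplying by the factor with \<open>r\<close> splits the former into indices
  near \<open>6 * k\<close> and \<open>2 * k\<close>. The signs depend only on \<open>r\<close> and
  \<open>t\<close>, since \<open>2 * k\<close> is even.\<close>

lemma fibz_fibz_fibz_shift:
  "5 * (real_of_int (fibz (2 * k + r)) * real_of_int (fibz (2 * k + s)) * real_of_int (fibz (2 * k + t)))
    = real_of_int (fibz (6 * k + (s + r + t))) - (- 1) powi r * real_of_int (fibz (2 * k + (s + t - r)))
      - (- 1) powi t * real_of_int (lucasz (s - t)) * real_of_int (fibz (2 * k + r))"
  using fibz_mult_fibz[of "2 * k + s" "2 * k + t", unfolded pair_simps]
    lucasz_mult_fibz[of "4 * k + (s + t)" "2 * k + r", unfolded triple_simps]
  by algebra

lemma lucasz_fibz_fibz_shift: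
  "5 * (real_of_int (lucasz (2 * k + r)) * real_of_int (fibz (2 * k + s)) * real_of_int (fibz (2 * k + t)))
    = real_of_int (lucasz (6 * k + (s + r + t))) + (- 1) powi r * real_of_int (lucasz (2 * k + (s + t - r)))
      - (- 1) powi t * real_of_int (lucasz (s - t)) * real_of_int (lucasz (2 * k + r))"
  using fibz_mult_fibz[of "2 * k + s" "2 * k + t", unfolded pair_simps]
    lucasz_mult_lucasz[of "4 * k + (s + t)" "2 * k + r", unfolded triple_simps]
  by algebra

text \<open>The pair combined first is mixed, so the constant is \<open>fibz (s - t)\<close> and it
  multiplies a Lucas number.\<close>

lemma lucasz_lucasz_fibz_shift:
  "real_of_int (lucasz (2 * k + r)) * real_of_int (lucasz (2 * k + s)) * real_of_int (fibz (2 * k + t))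
    = real_of_int (fibz (6 * k + (s + r + t))) + (- 1) powi r * real_of_int (fibz (2 * k + (s + t - r)))
      - (- 1) powi t * real_of_int (fibz (s - t)) * real_of_int (lucasz (2 * k + r))"
  using lucasz_mult_fibz[of "2 * k + s" "2 * k + t", unfolded pair_simps]
    fibz_mult_lucasz[of "4 * k + (s + t)" "2 * k + r", unfolded triple_simps]
  by algebra

lemma lucasz_lucasz_lucasz_shift:
  "real_of_int (lucasz (2 * k + r)) * real_of_int (lucasz (2 * k + s)) * real_of_int (lucasz (2 * k + t))
    = real_of_int (lucasz (6 * k + (s + r + t))) + (- 1) powi r * real_of_int (lucasz (2 * k + (s + t - r)))
      + (- 1) powi t * real_of_int (lucasz (s - t)) * real_of_int (lucasz (2 * k + r))"
  using lucasz_mult_lucasz[of "2 * k + s" "2 * k + t", unfolded pair_simps]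
    lucasz_mult_lucasz[of "4 * k + (s + t)" "2 * k + r", unfolded triple_simps]
  by algebra

end

section \<open>From termwise identities to binomial sums\<close>

lemma weighted_sum_linear:
  fixes w :: "'b \<Rightarrow> 'a :: comm_ring_1"
  assumes "\<forall>k\<in>A. c * h k = u k + a * v k + b * z k"
  shows "2 * c * (\<Sum>k\<in>A. w k * h k)
    = 2 * (\<Sum>k\<in>A. w k * u k) + a * (2 * (\<Sum>k\<in>A. w k * v k)) + b * (2 * (\<Sum>k\<in>A. w k * z k))"
proof -
  have "c * (\<Sum>k\<in>A. w k * h k) = (\<Sum>k\<in>A. w k * (c * h k))"
    by (simp add: sum_distrib_left mult.left_commute)
  also have "\<dots> = (\<Sum>k\<in>A. w k * u k) + a * (\<Sum>k\<in>A. w k * v k) + b * (\<Sum>k\<in>A. w k * z k)"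
    using assms by (simp add: sum.distrib sum_distrib_left algebra_simps)
  finally show ?thesis by (simp add: mult.assoc distrib_left mult.left_commute)
qed

theorem theorem31:
  fixes n :: nat and r s t :: int
  shows
    "  (10 * (\<Sum>k = 0..n div 2. real (n choose (2 * k))
         * real_of_int (fibz (2 * int k + r)) * real_of_int (fibz (2 * int k + s)) * real_of_int (fibz (2 * int k + t)))
     = 2 ^ n * (real_of_int (fibz (2 * int n + s + r + t)) + (-1) ^ n * real_of_int (fibz (int n + s + r + t)))
       - (-1) powi r * (real_of_int (fibz (2 * int n + s + t - r))
                        - (-1) powi (s + t - r) * real_of_int (fibz (int n - s - t + r)))
       - (-1) powi t * real_of_int (lucasz (s - t))
           * (real_of_int (fibz (2 * int n + r)) - (-1) powi r * real_of_int (fibz (int n - r))))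
     \<and> (10 * (\<Sum>k = 0..n div 2. real (n choose (2 * k))
         * real_of_int (lucasz (2 * int k + r)) * real_of_int (fibz (2 * int k + s)) * real_of_int (fibz (2 * int k + t)))
     = 2 ^ n * (real_of_int (lucasz (2 * int n + s + r + t)) + (-1) ^ n * real_of_int (lucasz (int n + s + r + t)))
       + (-1) powi r * (real_of_int (lucasz (2 * int n + s + t - r))
                        + (-1) powi (s + t - r) * real_of_int (lucasz (int n - s - t + r)))
       - (-1) powi t * real_of_int (lucasz (s - t))
           * (real_of_int (lucasz (2 * int n + r)) + (-1) powi r * real_of_int (lucasz (int n - r))))
     \<and> (2 * (\<Sum>k = 0..n div 2. real (n choose (2 * k))
         * real_of_int (lucasz (2 * int k + r)) * real_of_int (lucasz (2 * int k + s)) * real_of_int (fibz (2 * int k + t)))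
     = 2 ^ n * (real_of_int (fibz (2 * int n + s + r + t)) + (-1) ^ n * real_of_int (fibz (int n + s + r + t)))
       + (-1) powi r * (real_of_int (fibz (2 * int n + s + t - r))
                        - (-1) powi (s + t - r) * real_of_int (fibz (int n - s - t + r)))
       - (-1) powi t * real_of_int (fibz (s - t))
           * (real_of_int (lucasz (2 * int n + r)) + (-1) powi r * real_of_int (lucasz (int n - r))))
     \<and> (2 * (\<Sum>k = 0..n div 2. real (n choose (2 * k))
         * real_of_int (lucasz (2 * int k + r)) * real_of_int (lucasz (2 * int k + s)) * real_of_int (lucasz (2 * int k + t)))
     = 2 ^ n * (real_of_int (lucasz (2 * int n + s + r + t)) + (-1) ^ n * real_of_int (lucasz (int n + s + r + t)))
       + (-1) powi r * (real_of_int (lucasz (2 * int n + s + t - r))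
                        + (-1) powi (s + t - r) * real_of_int (lucasz (int n - s - t + r)))
       + (-1) powi t * real_of_int (lucasz (s - t))
           * (real_of_int (lucasz (2 * int n + r)) + (-1) powi r * real_of_int (lucasz (int n - r))))"
proof -
  \<comment> \<open>Regrouping shows a single shift \<open>m\<close>, equal to
    \<open>s + r + t\<close> or \<open>s + t - r\<close>, as in the summation lemmas.\<close>
  have indices: "2 * int n + s + r + t = 2 * int n + (s + r + t)" "int n + s + r + t = int n + (s + r + t)"
    "2 * int n + s + t - r = 2 * int n + (s + t - r)" "int n - s - t + r = int n - (s + t - r)"
    by simp_all
  show ?thesis
    unfolding indices
  proof (intro conjI, goal_cases)
    case 1
    \<comment> \<open>Subtractions become negated coefficients to fit the hypothesis of
      \<open>weighted_sum_linear\<close>.\<close>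
    have "\<forall>k\<in>{0..n div 2}. 5 * (real_of_int (fibz (2 * int k + r)) * real_of_int (fibz (2 * int k + s)) * real_of_int (fibz (2 * int k + t)))
        = real_of_int (fibz (6 * int k + (s + r + t)))
          + - ((- 1) powi r) * real_of_int (fibz (2 * int k + (s + t - r)))
          + - ((- 1) powi t * real_of_int (lucasz (s - t))) * real_of_int (fibz (2 * int k + r))"
      using fibz_fibz_fibz_shift[of _ r s t] by simp
    \<comment> \<open>With \<open>c = 5\<close> the left side gets the factor 10, and each doubled
      sum on the right is one already evaluated.\<close>
    from weighted_sum_linear[OF this, where w = "\<lambda>k. real (n choose (2 * k))"]
    show ?case
      unfolding sum_even_binomial_fibz_6 sum_even_binomial_fibz_2
      by (simp add: mult.assoc)
  next
    case 2
    have "\<forall>k\<in>{0..n div 2}. 5 * (real_of_int (lucasz (2 * int k + r)) * real_of_int (fibz (2 * int k + s)) * real_of_int (fibz (2 * int k + t)))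
        = real_of_int (lucasz (6 * int k + (s + r + t)))
          + (- 1) powi r * real_of_int (lucasz (2 * int k + (s + t - r)))
          + - ((- 1) powi t * real_of_int (lucasz (s - t))) * real_of_int (lucasz (2 * int k + r))"
      using lucasz_fibz_fibz_shift[of _ r s t] by simp
    from weighted_sum_linear[OF this, where w = "\<lambda>k. real (n choose (2 * k))"]
    show ?case
      unfolding sum_even_binomial_lucasz_6 sum_even_binomial_lucasz_2
      by (simp add: mult.assoc)
  next
    case 3
    \<comment> \<open>The factor 1 plays the part of \<open>c\<close>: with at most one Fibonacci
      factor no 5 arises, and the leading constant is 2.\<close>
    have "\<forall>k\<in>{0..n div 2}. 1 * (real_of_int (lucasz (2 * int k + r)) * real_of_int (lucasz (2 * int k + s)) * real_of_int (fibz (2 * int k + t)))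
        = real_of_int (fibz (6 * int k + (s + r + t)))
          + (- 1) powi r * real_of_int (fibz (2 * int k + (s + t - r)))
          + - ((- 1) powi t * real_of_int (fibz (s - t))) * real_of_int (lucasz (2 * int k + r))"
      using lucasz_lucasz_fibz_shift[of _ r s t] by simp
    from weighted_sum_linear[OF this, where w = "\<lambda>k. real (n choose (2 * k))"]
    show ?case
      unfolding sum_even_binomial_fibz_6 sum_even_binomial_fibz_2 sum_even_binomial_lucasz_2
      by (simp add: mult.assoc)
  next
    case 4
    have "\<forall>k\<in>{0..n div 2}. 1 * (real_of_int (lucasz (2 * int k + r)) * real_of_int (lucasz (2 * int k + s)) * real_of_int (lucasz (2 * int k + t)))
        = real_of_int (lucasz (6 * int k + (s + r + t)))
          + (- 1) powi r * real_of_int (lucasz (2 * int k + (s + t - r)))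
          + (- 1) powi t * real_of_int (lucasz (s - t)) * real_of_int (lucasz (2 * int k + r))"
      using lucasz_lucasz_lucasz_shift[of _ r s t] by simp
    from weighted_sum_linear[OF this, where w = "\<lambda>k. real (n choose (2 * k))"]
    show ?case
      unfolding sum_even_binomial_lucasz_6 sum_even_binomial_lucasz_2
      by (simp add: mult.assoc)
  qed
qed

end
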